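(* Let $\mathfrak{J}:\mathcal{S}\to\mathbb{R}_{\ge 0}$ be a set function satisfying the standing assumptions given in the context, and assume $\dim_\infty(\mathfrak{J})>0$. Consider the convex function $$c:q\mapsto\limsup_{n\to\infty}\tau_n(q+q_n),$$ where $q_n$ denotes the only zero of $\tau_n$ ($n$ large). Then for $a\le b<0$ such that the subdifferential $\partial c(0)$ of $c$ at $0$ is equal to $[a,b]$, we have $$\frac{b}{a}\,\underline{\mathfrak{q}}\le\underline{F}\le\underline{\mathfrak{q}}.$$
   Context: Dyadic cubes. Let $d\in\mathbb{N}$. A dyadic cube of side length $2^{-n}$ is a product $I_1\times\cdots\times I_d$ of intervals of length $2^{-n}$ (each half-open, open, or closed) with endpoints in $\{k2^{-n}:k\in\mathbb{Z}\}$. Fix a dyadic unit cube $\mathcal{Q}\subset\mathbb{R}^d$ and partitions $\mathcal{D}_n$ of $\mathcal{Q}$ into dyadic cubes of side length $2^{-n}$ with $\mathcal{D}_0=\{\mathcal{Q}\}$ and such that each element of $\mathcal{D}_n$ is the disjoint union of exactly $2^d$ elements of $\mathcal{D}_{n+1}$. Put $\mathcal{D}=\bigcup_{n\ge0}\mathcal{D}_n$. Fix a subset $\mathcal{S}\subset\mathcal{D}$ and put $\mathcal{S}_n=\mathcal{S}\cap\mathcal{D}_n$. Standing assumptions on $\mathfrak{J}:\mathcal{S}\to\mathbb{R}_{\ge0}$: (1) non-trivial: $\mathfrak{J}\not\equiv0$; (2) monotone: $Q\subset Q'$ in $\mathcal{S}$ implies $\mathfrak{J}(Q)\le\mathfrak{J}(Q')$;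 (3) uniformly vanishing: $\sup\{\mathfrak{J}(Q):Q\in\bigcup_{k\ge n}\mathcal{S}_k\}\to0$ as $n\to\infty$; (4) locally non-vanishing: for every $n\ge 0$ and $Q\in\mathcal{S}_n$ with $\mathfrak{J}(Q)>0$ there is $Q'\in\mathcal{S}_{n+1}$ with $Q'\subset Q$ and $\mathfrak{J}(Q')>0$; (5) there exist $a_0>0$, $b_0\in\mathbb{R}$ with $\tau_n(a_0)\ge b_0$ for all large $n$. Definitions. $\tau_n(q)=\frac{1}{\log 2^n}\log\sum_{Q\in\mathcal{S}_n,\,\mathfrak{J}(Q)>0}\mathfrak{J}(Q)^q$, for real $q$. For all large $n$ the function $\tau_n$ is strictly decreasing on $[0,\infty)$ with a unique zero $q_n\ge0$; $\underline{\mathfrak{q}}=\liminf_{n\to\infty}q_n$. $\dim_\infty(\mathfrak{J})=\liminf_{n\to\infty}\frac{\log\max_{Q\in\mathcal{S}_n}\mathfrak{J}(Q)}{-\log 2^n}$. The subdifferential of $c$ at $0$ is $\partial c(0)=\{s\in\mathbb{R}:c(q)\ge c(0)+sq\ \text{for all } q\}$. For $\alpha>0$, $N_\alpha(n)=\operatorname{card}\{Q\in\mathcal{S}_n:\mathfrak{J}(Q)\ge2^{-\alpha n}\}$, $\underline{F}(\alpha)=\liminf_{n}\frac{\log^+N_\alpha(n)}{\log2^n}$ with $\log^+(y)=\max\{0,\log y\}$ ($\log^+0=0$), and $\underline{F}=\sup_{\alpha>0}\underline{F}(\alpha)/\alpha$. *)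

theory Defs
  imports "HOL-Analysis.Analysis"
begin

definition dyadic_interval :: "nat \<Rightarrow> real set \<Rightarrow> bool" where
  "dyadic_interval n I \<longleftrightarrow>
     (\<exists>k::int. let l = of_int k / 2 ^ n; u = of_int (k + 1) / 2 ^ n
               in I \<in> {{l..u}, {l<..u}, {l..<u}, {l<..<u}})"

text \<open>The kind of interval (closed, open, half-open on either side) may differ between
  the coordinates.\<close>

definition dyadic_cube :: "nat \<Rightarrow> (real ^ 'd) set \<Rightarrow> bool" where
  "dyadic_cube n Q \<longleftrightarrow>
     (\<exists>I :: 'd \<Rightarrow> real set. (\<forall>i. dyadic_interval n (I i)) \<and> Q = {x. \<forall>i. x $ i \<in> I i})"

definition dyadic_partitions :: "(real ^ 'd) set \<Rightarrow> (nat \<Rightarrow> (real ^ 'd) set set) \<Rightarrow> bool" where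
  "dyadic_partitions Q0 D \<longleftrightarrow>
     dyadic_cube 0 Q0 \<and>
     D 0 = {Q0} \<and>
     (\<forall>n. partition_on Q0 (D n) \<and> (\<forall>Q\<in>D n. dyadic_cube n Q)) \<and>
     (\<forall>n. \<forall>Q\<in>D n. \<exists>C \<subseteq> D (Suc n). card C = 2 ^ CARD('d) \<and> disjoint C \<and> \<Union>C = Q)"

definition level :: "(nat \<Rightarrow> 'a set set) \<Rightarrow> 'a set set \<Rightarrow> nat \<Rightarrow> 'a set set" where
  "level D S n = S \<inter> D n"

text \<open>The convention \<open>ln 0 = 0\<close> and the division by \<open>ln (2 ^ 0) = 0\<close> only affect the
  values of \<open>tau\<close>, \<open>zero_seq\<close> and \<open>dim_infinity\<close> at finitely many \<open>n\<close>: under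
  the standing assumptions below the sum and the maximum are positive for all large \<open>n\<close>.\<close>

definition tau :: "(nat \<Rightarrow> 'a set set) \<Rightarrow> 'a set set \<Rightarrow> ('a set \<Rightarrow> real) \<Rightarrow> nat \<Rightarrow> real \<Rightarrow> real" where
  "tau D S J n q = 1 / ln (2 ^ n) * ln (\<Sum>Q | Q \<in> level D S n \<and> J Q > 0. J Q powr q)"

text \<open>The set function is only meaningful on \<open>S\<close>; its values elsewhere are never used.
  The supremum over all finer levels is taken in the extended reals, so that an unbounded family does not
  get a spurious finite supremum.\<close>

definition standing_assumptions ::
    "(nat \<Rightarrow> 'a set set) \<Rightarrow> 'a set set \<Rightarrow> ('a set \<Rightarrow> real) \<Rightarrow> bool" where
  "standing_assumptions D S J \<longleftrightarrow>
     (\<forall>Q\<in>S. J Q \<ge> 0) \<and>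
     (\<exists>Q\<in>S. J Q \<noteq> 0) \<and>
     (\<forall>Q\<in>S. \<forall>Q'\<in>S. Q \<subseteq> Q' \<longrightarrow> J Q \<le> J Q') \<and>
     (\<lambda>n. SUP Q \<in> (\<Union>k\<in>{n..}. level D S k). ereal (J Q)) \<longlonglongrightarrow> 0 \<and>
     (\<forall>n. \<forall>Q\<in>level D S n. J Q > 0 \<longrightarrow> (\<exists>Q'\<in>level D S (Suc n). Q' \<subseteq> Q \<and> J Q' > 0)) \<and>
     (\<exists>a0 > 0. \<exists>b0. \<forall>\<^sub>F n in sequentially. tau D S J n a0 \<ge> b0)"

definition zero_seq :: "(nat \<Rightarrow> 'a set set) \<Rightarrow> 'a set set \<Rightarrow> ('a set \<Rightarrow> real) \<Rightarrow> nat \<Rightarrow> real" where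
  "zero_seq D S J n = (THE q. q \<ge> 0 \<and> tau D S J n q = 0)"

definition q_lower :: "(nat \<Rightarrow> 'a set set) \<Rightarrow> 'a set set \<Rightarrow> ('a set \<Rightarrow> real) \<Rightarrow> ereal" where
  "q_lower D S J = liminf (\<lambda>n. ereal (zero_seq D S J n))"

definition dim_infinity :: "(nat \<Rightarrow> 'a set set) \<Rightarrow> 'a set set \<Rightarrow> ('a set \<Rightarrow> real) \<Rightarrow> ereal" where
  "dim_infinity D S J =
     liminf (\<lambda>n. ereal (ln (Max (J ` level D S n)) / - ln (2 ^ n)))"

text \<open>Extended-real valued: the upper limit may be \<open>\<infinity>\<close> for negative \<open>q\<close>.\<close>

definition c_fun :: "(nat \<Rightarrow> 'a set set) \<Rightarrow> 'a set set \<Rightarrow> ('a set \<Rightarrow> real) \<Rightarrow> real \<Rightarrow> ereal" where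
  "c_fun D S J q = limsup (\<lambda>n. ereal (tau D S J n (q + zero_seq D S J n)))"

definition subdifferential_0 :: "(real \<Rightarrow> ereal) \<Rightarrow> real set" where
  "subdifferential_0 c = {s. \<forall>q. c q \<ge> c 0 + ereal (s * q)}"

text \<open>Since \<open>ln 0 = 0\<close>, this gives \<open>log_plus 0 = 0\<close>.\<close>

definition log_plus :: "real \<Rightarrow> real" where
  "log_plus y = max 0 (ln y)"

definition N_count ::
    "(nat \<Rightarrow> 'a set set) \<Rightarrow> 'a set set \<Rightarrow> ('a set \<Rightarrow> real) \<Rightarrow> real \<Rightarrow> nat \<Rightarrow> nat" where
  "N_count D S J \<alpha> n = card {Q \<in> level D S n. J Q \<ge> 2 powr (- \<alpha> * real n)}"

definition F_lower_at ::
    "(nat \<Rightarrow> 'a set set) \<Rightarrow> 'a set set \<Rightarrow> ('a set \<Rightarrow> real) \<Rightarrow> real \<Rightarrow> ereal" where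
  "F_lower_at D S J \<alpha> =
     liminf (\<lambda>n. ereal (log_plus (real (N_count D S J \<alpha> n)) / ln (2 ^ n)))"

definition F_lower :: "(nat \<Rightarrow> 'a set set) \<Rightarrow> 'a set set \<Rightarrow> ('a set \<Rightarrow> real) \<Rightarrow> ereal" where
  "F_lower D S J = (SUP \<alpha>\<in>{0<..}. F_lower_at D S J \<alpha> / ereal \<alpha>)"

end

theory Submission
  imports Defs
begin

text \<open>
  Write \<open>q n\<close> for the zero of \<open>tau D S J n\<close>.  By its choice the weights \<open>J Q powr q n\<close>, for the
  cells \<open>Q\<close> of generation \<open>n\<close> with \<open>J Q > 0\<close>, form a probability distribution, and both bounds
  amount to reading off how many cells carry its mass.

  For the upper bound (\<open>F_lower_le_q_lower\<close>), a cell counted by \<open>N_count D S J \<alpha> n\<close> has mass at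
  least \<open>2 powr (- \<alpha> * n * q n)\<close>, so there are at most \<open>2 powr (\<alpha> * n * q n)\<close> of them.

  The lower bound is a large deviation argument.  The value \<open>tau D S J n (q + q n)\<close> is the scaled
  logarithmic moment generating function of \<open>log 2 (J Q)\<close> under this distribution, and
  \<open>c_fun D S J\<close> is its upper limit, which vanishes at \<open>0\<close>.  A real \<open>s\<close> outside the
  subdifferential \<open>{a..b}\<close> comes with a \<open>q\<close> such that \<open>c q < s * q\<close>; here \<open>q < 0\<close> if \<open>s < a\<close> and
  \<open>q > 0\<close> if \<open>s > b\<close>.  Chernoff's inequality with this \<open>q\<close> shows that the cells with
  \<open>J Q < 2 powr (- \<alpha> * n)\<close>, where \<open>\<alpha> > - a\<close>, and those with \<open>J Q > 2 powr (- \<beta> * n)\<close>, where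
  \<open>\<beta> < - b\<close>, carry exponentially small mass (\<open>lower_tail_vanishes\<close>, \<open>upper_tail_vanishes\<close>).
  For large \<open>n\<close> at least half of the mass therefore lies on cells of value between
  \<open>2 powr (- \<alpha> * n)\<close> and \<open>2 powr (- \<beta> * n)\<close>.  Each of them has mass at most
  \<open>2 powr (- \<beta> * n * q n)\<close>, so there are at least \<open>2 powr (\<beta> * n * q n) / 2\<close> of them
  (\<open>eventually_N_count_ge\<close>).  Hence \<open>F_lower D S J\<close> is at least \<open>\<beta> / \<alpha>\<close> times
  \<open>q_lower D S J\<close>, and letting \<open>\<alpha>\<close> tend to \<open>- a\<close> and \<open>\<beta>\<close> to \<open>- b\<close> gives the factor \<open>b / a\<close>.
\<close>

section \<open>Power sums over a finite set\<close>

text \<open>The power sum is continuous and strictly decreasing in the exponent, starts at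
  \<open>card A \<ge> 1\<close> and tends to \<open>0\<close>.\<close>

lemma power_sum_unique_one:
  fixes f :: "'a \<Rightarrow> real"
  assumes "finite A" "A \<noteq> {}" and f: "\<And>x. x \<in> A \<Longrightarrow> 0 < f x \<and> f x < 1"
  shows "\<exists>!q. q \<ge> 0 \<and> (\<Sum>x\<in>A. f x powr q) = 1"
proof -
  let ?g = "\<lambda>q. \<Sum>x\<in>A. f x powr q"
  have less: "?g q' < ?g q" if "q < q'" for q q'
    using assms that by (intro sum_strict_mono powr_less_mono') auto
  have cont: "continuous_on {0..y} ?g" for y
    using f by (intro continuous_intros) force+
  have "(?g \<longlongrightarrow> (\<Sum>x\<in>A. 0)) at_top"
  proof (intro tendsto_sum)
    fix x assume "x \<in> A"
    with f have "0 < f x" "ln (f x) < 0" by auto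
    hence "filterlim (\<lambda>q. ln (f x) * q) at_bot at_top"
      by (intro filterlim_tendsto_neg_mult_at_bot[OF tendsto_const _ filterlim_ident])
    from filterlim_compose[OF exp_at_bot this] show "((\<lambda>q. f x powr q) \<longlongrightarrow> 0) at_top"
      using \<open>0 < f x\<close> by (simp add: powr_def mult.commute)
  qed
  hence "eventually (\<lambda>q. ?g q < 1) at_top"
    by (intro order_tendstoD(2)) auto
  then obtain y where y: "y \<ge> 0" "?g y < 1"
    by (metis (no_types, lifting) eventually_at_top_linorder linorder_le_cases order_refl)
  have "?g 0 = real (card A)"
    using f by (force intro: trans[OF sum.cong[of A A _ "\<lambda>_. 1"]])
  moreover have "card A \<ge> 1"
    using assms by (simp add: Suc_le_eq card_gt_0_iff)
  ultimately have "?g 0 \<ge> 1" by simp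
  with IVT2'[OF less_imp_le[OF y(2)] _ y(1) cont]
  obtain q where "q \<ge> 0" "?g q = 1" by auto
  moreover have "q = q'" if "?g q = 1" "?g q' = 1" for q q'
    using less[of q q'] less[of q' q] that by (cases q q' rule: linorder_cases) auto
  ultimately show ?thesis by blast
qed

text \<open>Markov's inequality for the exponentially tilted weights.  The sign of \<open>t\<close> is left open, so
  that one inequality serves both tails: \<open>B\<close> may consist of points where \<open>f\<close> is small (\<open>t < 0\<close>)
  or large (\<open>t > 0\<close>).\<close>

lemma power_sum_markov:
  fixes f :: "'a \<Rightarrow> real"
  assumes "finite A" "B \<subseteq> A" and f: "\<And>x. x \<in> A \<Longrightarrow> f x > 0"
    and z: "\<And>x. x \<in> B \<Longrightarrow> f x powr (- t) \<le> z" and "z \<ge> 0"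
  shows "(\<Sum>x\<in>B. f x powr q) \<le> z * (\<Sum>x\<in>A. f x powr (t + q))"
proof -
  have "(\<Sum>x\<in>B. f x powr q) = (\<Sum>x\<in>B. f x powr (- t) * f x powr (t + q))"
    by (simp flip: powr_add)
  also have "\<dots> \<le> (\<Sum>x\<in>B. z * f x powr (t + q))"
    using z by (intro sum_mono mult_right_mono) auto
  also have "\<dots> \<le> (\<Sum>x\<in>A. z * f x powr (t + q))"
    using assms by (intro sum_mono2) auto
  finally show ?thesis by (simp add: sum_distrib_left)
qed

section \<open>Zeros of the partition functions\<close>

text \<open>The consequences of the standing assumptions from which the zeros of \<open>tau\<close> and the
  comparison of the exponents can be derived.\<close>

locale small_cells =
  fixes D :: "nat \<Rightarrow> 'a set set" and S :: "'a set set" and J :: "'a set \<Rightarrow> real"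
  assumes finite_level: "finite (level D S n)"
    and eventually_positive: "\<forall>\<^sub>F n in sequentially. \<exists>Q\<in>level D S n. J Q > 0"
    and eventually_less_1: "\<forall>\<^sub>F n in sequentially. \<forall>Q\<in>level D S n. J Q < 1"
begin

abbreviation cells :: "nat \<Rightarrow> 'a set set" where
  "cells n \<equiv> {Q. Q \<in> level D S n \<and> J Q > 0}"

abbreviation zero :: "nat \<Rightarrow> real" where
  "zero n \<equiv> zero_seq D S J n"

lemma finite_cells: "finite (cells n)"
  using finite_level[of n] by (rule rev_finite_subset) auto

text \<open>The description in \<open>zero_seq_def\<close> is proper for large \<open>n\<close>: as soon as all values on the
  generation are less than \<open>1\<close>, the power sum takes the value \<open>1\<close> exactly once.\<close>

lemma eventually_power_sum_zero_seq:
  "\<forall>\<^sub>F n in sequentially. zero n \<ge> 0 \<and> (\<Sum>Q\<in>cells n. J Q powr zero n) = 1"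
  using eventually_positive eventually_less_1 eventually_gt_at_top[of 0]
proof eventually_elim
  case (elim n)
  let ?g = "\<lambda>q. \<Sum>Q\<in>cells n. J Q powr q"
  from elim have ne: "cells n \<noteq> {}" by blast
  have pos: "?g q > 0" for q
    using finite_cells ne by (intro sum_pos) auto
  have "ln (2 ^ n :: real) \<noteq> 0"
    using elim(3) by (simp add: ln_realpow)
  hence "tau D S J n q = 0 \<longleftrightarrow> ?g q = 1" for q
    unfolding tau_def ln_eq_zero_iff[OF pos, symmetric] by auto
  hence "zero n = (THE q. q \<ge> 0 \<and> ?g q = 1)"
    by (simp add: zero_seq_def)
  moreover have "\<exists>!q. q \<ge> 0 \<and> ?g q = 1"
    using finite_cells ne elim(2) by (intro power_sum_unique_one) auto
  ultimately show ?case
    using theI'[of "\<lambda>q. q \<ge> 0 \<and> ?g q = 1"] by simp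
qed

lemma c_fun_0: "c_fun D S J 0 = 0"
proof -
  have "\<forall>\<^sub>F n in sequentially. ereal (tau D S J n (0 + zero n)) = 0"
    using eventually_power_sum_zero_seq by eventually_elim (simp add: tau_def)
  hence "(\<lambda>n. ereal (tau D S J n (0 + zero n))) \<longlonglongrightarrow> 0"
    by (rule tendsto_eventually)
  thus ?thesis
    unfolding c_fun_def by (intro lim_imp_Limsup) auto
qed

section \<open>Upper bound for the counting exponent\<close>

lemma F_lower_le_q_lower: "F_lower D S J \<le> q_lower D S J"
  unfolding F_lower_def
proof (rule SUP_least)
  fix \<alpha> :: real assume "\<alpha> \<in> {0<..}"
  hence \<alpha>: "\<alpha> > 0" by simp
  have "F_lower_at D S J \<alpha> \<le> liminf (\<lambda>n. ereal \<alpha> * ereal (zero n))"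
    unfolding F_lower_at_def
  proof (rule Liminf_mono)
    show "\<forall>\<^sub>F n in sequentially. ereal (log_plus (real (N_count D S J \<alpha> n)) / ln (2 ^ n))
            \<le> ereal \<alpha> * ereal (zero n)"
      using eventually_power_sum_zero_seq eventually_gt_at_top[of 0]
    proof eventually_elim
      case (elim n)
      define B where "B = {Q \<in> level D S n. J Q \<ge> 2 powr (- \<alpha> * real n)}"
      have "B \<subseteq> cells n"
        unfolding B_def using less_le_trans[of 0 "2 powr (- \<alpha> * real n)"] by force
      have "real (card B) * (2 powr (- \<alpha> * real n)) powr zero n
              = (\<Sum>Q\<in>B. (2 powr (- \<alpha> * real n)) powr zero n)"
        by simp
      also have "\<dots> \<le> (\<Sum>Q\<in>B. J Q powr zero n)"
        using elim by (intro sum_mono powr_mono2) (auto simp: B_def)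
      also have "\<dots> \<le> (\<Sum>Q\<in>cells n. J Q powr zero n)"
        using finite_cells \<open>B \<subseteq> cells n\<close> by (intro sum_mono2) auto
      finally have "real (card B) * 2 powr (- (\<alpha> * real n * zero n)) \<le> 1"
        using elim by (simp add: powr_powr)
      hence card: "real (card B) \<le> 2 powr (\<alpha> * real n * zero n)"
        by (simp add: powr_minus field_simps)
      have "log_plus (real (card B)) \<le> \<alpha> * real n * zero n * ln 2"
      proof (cases "card B = 0")
        case False
        hence "ln (real (card B)) \<le> ln (2 powr (\<alpha> * real n * zero n))"
          using card by (subst ln_le_cancel_iff) auto
        thus ?thesis
          using elim \<alpha> by (simp add: log_plus_def ln_powr)
      qed (use elim \<alpha> in \<open>simp add: log_plus_def\<close>)
      moreover have "N_count D S J \<alpha> n = card B"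
        by (simp add: N_count_def B_def)
      ultimately show ?case
        using elim by (simp add: ln_realpow field_simps)
    qed
  qed
  also have "\<dots> = ereal \<alpha> * q_lower D S J"
    unfolding q_lower_def using \<alpha> by (intro Liminf_ereal_mult_left) auto
  finally show "F_lower_at D S J \<alpha> / ereal \<alpha> \<le> q_lower D S J"
    using \<alpha> by (simp add: ereal_divide_le_pos)
qed

section \<open>Concentration between the two extreme slopes\<close>

text \<open>Chernoff's inequality.  The tilted sum grows at most like \<open>2 powr (s * q * n)\<close> because of
  \<open>slope\<close>, while passing from the weights \<open>J Q powr zero n\<close> to the tilted ones gains
  \<open>2 powr (\<gamma> * q * n)\<close> on the tail; \<open>gap\<close> makes the product decay geometrically.  Here \<open>- \<gamma>\<close> is
  the exponential rate at which the tail is cut off, and the sign of \<open>q\<close> decides on which side.\<close>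

lemma exponential_tail_vanishes:
  assumes slope: "c_fun D S J q < ereal (s * q)" and gap: "(s + \<gamma>) * q < 0"
    and B: "\<And>n. B n \<subseteq> cells n"
    and tail: "\<And>n Q. Q \<in> B n \<Longrightarrow> J Q powr (- q) \<le> 2 powr (\<gamma> * real n * q)"
  shows "(\<lambda>n. \<Sum>Q\<in>B n. J Q powr zero n) \<longlonglongrightarrow> 0"
proof (rule tendsto_sandwich)
  show "\<forall>\<^sub>F n in sequentially. 0 \<le> (\<Sum>Q\<in>B n. J Q powr zero n)"
    by (intro always_eventually allI sum_nonneg) auto
  have "\<forall>\<^sub>F n in sequentially. ereal (tau D S J n (q + zero n)) < ereal (s * q)"
    using slope unfolding c_fun_def by (rule Limsup_lessD)
  thus "\<forall>\<^sub>F n in sequentially. (\<Sum>Q\<in>B n. J Q powr zero n) \<le> (2 powr ((s + \<gamma>) * q)) ^ n"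
    using eventually_positive eventually_gt_at_top[of 0]
  proof eventually_elim
    case (elim n)
    define Z where "Z = (\<Sum>Q\<in>cells n. J Q powr (q + zero n))"
    have "Z > 0"
      unfolding Z_def using finite_cells elim by (intro sum_pos) auto
    have "ln Z < s * q * real n * ln 2"
      using elim by (simp add: tau_def Z_def ln_realpow field_simps)
    hence "ln Z < ln (2 powr (s * q * real n))"
      by (simp add: ln_powr)
    hence Z: "Z \<le> 2 powr (s * q * real n)"
      using \<open>Z > 0\<close> by (subst (asm) ln_less_cancel_iff) auto
    have "(\<Sum>Q\<in>B n. J Q powr zero n) \<le> 2 powr (\<gamma> * real n * q) * Z"
      unfolding Z_def using finite_cells B tail by (intro power_sum_markov) auto
    also have "\<dots> \<le> 2 powr (\<gamma> * real n * q) * 2 powr (s * q * real n)"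
      using Z by (intro mult_left_mono) auto
    also have "\<dots> = 2 powr (((s + \<gamma>) * q) * real n)"
      by (simp flip: powr_add add: algebra_simps)
    also have "\<dots> = (2 powr ((s + \<gamma>) * q)) ^ n"
      by (simp add: powr_powr flip: powr_realpow)
    finally show ?case .
  qed
  have "2 powr ((s + \<gamma>) * q) < 2 powr 0"
    using gap by (intro powr_less_mono) auto
  thus "(\<lambda>n. (2 powr ((s + \<gamma>) * q)) ^ n) \<longlonglongrightarrow> 0"
    by (intro LIMSEQ_realpow_zero) auto
qed auto

lemma not_subgradientE:
  assumes "s \<notin> subdifferential_0 (c_fun D S J)"
  obtains q where "c_fun D S J q < ereal (s * q)"
  using assms c_fun_0 by (auto simp: subdifferential_0_def not_le)

lemma subgradientD:
  assumes "s \<in> subdifferential_0 (c_fun D S J)"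
  shows "ereal (s * q) \<le> c_fun D S J q"
  using assms c_fun_0 by (auto simp: subdifferential_0_def)

text \<open>An \<open>s\<close> strictly between \<open>- \<alpha>\<close> and \<open>a\<close> is not a subgradient, but \<open>a\<close> is.  The point \<open>q\<close>
  at which \<open>s\<close> fails must therefore be negative, which is the right sign for tilting towards the
  small values of \<open>J\<close>.\<close>

lemma lower_tail_vanishes:
  assumes sub: "subdifferential_0 (c_fun D S J) = {a..b}" and "a \<le> b" and \<alpha>: "- a < \<alpha>"
  shows "(\<lambda>n. \<Sum>Q | Q \<in> cells n \<and> J Q < 2 powr (- \<alpha> * real n). J Q powr zero n) \<longlonglongrightarrow> 0"
proof -
  obtain s where s: "- \<alpha> < s" "s < a"
    using dense[of "- \<alpha>" a] \<alpha> by auto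
  obtain q where q: "c_fun D S J q < ereal (s * q)"
    using not_subgradientE[of s] sub s by auto
  moreover have "ereal (a * q) \<le> c_fun D S J q"
    using sub \<open>a \<le> b\<close> by (intro subgradientD) auto
  ultimately have "ereal (a * q) < ereal (s * q)" by order
  hence "(a - s) * q < 0" by (simp add: algebra_simps)
  hence "q < 0" using s by (simp add: mult_less_0_iff)
  show ?thesis
  proof (rule exponential_tail_vanishes[OF q, of \<alpha>])
    show "(s + \<alpha>) * q < 0"
      using s \<open>q < 0\<close> by (intro mult_pos_neg) auto
    fix n Q assume Q: "Q \<in> {Q. Q \<in> cells n \<and> J Q < 2 powr (- \<alpha> * real n)}"
    hence "J Q powr (- q) \<le> (2 powr (- \<alpha> * real n)) powr (- q)"
      using \<open>q < 0\<close> by (intro powr_mono2) auto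
    thus "J Q powr (- q) \<le> 2 powr (\<alpha> * real n * q)"
      by (simp add: powr_powr)
  qed auto
qed

text \<open>The mirror image: an \<open>s\<close> strictly between \<open>b\<close> and \<open>- \<beta>\<close> fails at a positive \<open>q\<close>, which
  tilts towards the large values of \<open>J\<close>.\<close>

lemma upper_tail_vanishes:
  assumes sub: "subdifferential_0 (c_fun D S J) = {a..b}" and "a \<le> b" and \<beta>: "\<beta> < - b"
  shows "(\<lambda>n. \<Sum>Q | Q \<in> cells n \<and> J Q > 2 powr (- \<beta> * real n). J Q powr zero n) \<longlonglongrightarrow> 0"
proof -
  obtain s where s: "b < s" "s < - \<beta>"
    using dense[of b "- \<beta>"] \<beta> by auto
  obtain q where q: "c_fun D S J q < ereal (s * q)"
    using not_subgradientE[of s] sub s by auto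
  moreover have "ereal (b * q) \<le> c_fun D S J q"
    using sub \<open>a \<le> b\<close> by (intro subgradientD) auto
  ultimately have "ereal (b * q) < ereal (s * q)" by order
  hence "(s - b) * q > 0" by (simp add: algebra_simps)
  hence "q > 0" using s by (simp add: zero_less_mult_iff)
  show ?thesis
  proof (rule exponential_tail_vanishes[OF q, of \<beta>])
    show "(s + \<beta>) * q < 0"
      using s \<open>q > 0\<close> by (intro mult_neg_pos) auto
    fix n Q assume Q: "Q \<in> {Q. Q \<in> cells n \<and> J Q > 2 powr (- \<beta> * real n)}"
    hence "J Q powr (- q) \<le> (2 powr (- \<beta> * real n)) powr (- q)"
      using \<open>q > 0\<close> by (intro powr_mono2') auto
    thus "J Q powr (- q) \<le> 2 powr (\<beta> * real n * q)"
      by (simp add: powr_powr)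
  qed auto
qed

section \<open>Lower bound for the counting exponent\<close>

text \<open>Each tail eventually has mass below \<open>1 / 4\<close>.  The remaining half of the mass sits on cells
  that are too light individually, by the bound with \<open>\<beta>\<close>, to be few, and large enough, by the
  bound with \<open>\<alpha>\<close>, to be counted.\<close>

lemma eventually_N_count_ge:
  assumes sub: "subdifferential_0 (c_fun D S J) = {a..b}" and "a \<le> b"
    and "- a < \<alpha>" and "0 < \<beta>" and "\<beta> < - b"
  shows "\<forall>\<^sub>F n in sequentially. 2 powr (\<beta> * real n * zero n) / 2 \<le> real (N_count D S J \<alpha> n)"
proof -
  let ?low = "\<lambda>n. {Q. Q \<in> cells n \<and> J Q < 2 powr (- \<alpha> * real n)}"
  let ?high = "\<lambda>n. {Q. Q \<in> cells n \<and> J Q > 2 powr (- \<beta> * real n)}"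
  have "\<forall>\<^sub>F n in sequentially. (\<Sum>Q\<in>?low n. J Q powr zero n) < 1 / 4"
    using lower_tail_vanishes[OF sub] assms by (intro order_tendstoD(2)) auto
  moreover have "\<forall>\<^sub>F n in sequentially. (\<Sum>Q\<in>?high n. J Q powr zero n) < 1 / 4"
    using upper_tail_vanishes[OF sub] assms by (intro order_tendstoD(2)) auto
  ultimately show ?thesis
    using eventually_power_sum_zero_seq
  proof eventually_elim
    case (elim n)
    define M where "M = cells n - ?low n - ?high n"
    have fin: "finite M" "finite (?low n)" "finite (?high n)"
      unfolding M_def by (auto intro: rev_finite_subset[OF finite_cells[of n]])
    have union: "(\<Sum>Q\<in>A \<union> B. J Q powr zero n) \<le> (\<Sum>Q\<in>A. J Q powr zero n) + (\<Sum>Q\<in>B. J Q powr zero n)"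
      if "finite A" "finite B" for A B
      using sum.union_inter[OF that, of "\<lambda>Q. J Q powr zero n"]
        sum_nonneg[of "A \<inter> B" "\<lambda>Q. J Q powr zero n"] by simp
    have "1 = (\<Sum>Q\<in>cells n. J Q powr zero n)"
      using elim by simp
    also have "\<dots> \<le> (\<Sum>Q\<in>M \<union> (?low n \<union> ?high n). J Q powr zero n)"
      using fin by (intro sum_mono2) (auto simp: M_def)
    also have "\<dots> \<le> (\<Sum>Q\<in>M. J Q powr zero n) + (\<Sum>Q\<in>?low n \<union> ?high n. J Q powr zero n)"
      using fin by (intro union) auto
    also have "(\<Sum>Q\<in>?low n \<union> ?high n. J Q powr zero n)
        \<le> (\<Sum>Q\<in>?low n. J Q powr zero n) + (\<Sum>Q\<in>?high n. J Q powr zero n)"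
      using fin by (intro union) auto
    also have "(\<Sum>Q\<in>M. J Q powr zero n) \<le> (\<Sum>Q\<in>M. (2 powr (- \<beta> * real n)) powr zero n)"
      using elim by (intro sum_mono powr_mono2) (auto simp: M_def)
    also have "\<dots> = real (card M) * 2 powr (- (\<beta> * real n * zero n))"
      by (simp add: powr_powr)
    finally have "1 / 2 \<le> real (card M) * 2 powr (- (\<beta> * real n * zero n))"
      using elim by linarith
    hence "2 powr (\<beta> * real n * zero n) / 2 \<le> real (card M)"
      by (simp add: powr_minus field_simps)
    also have "card M \<le> N_count D S J \<alpha> n"
      unfolding N_count_def using finite_level[of n] by (intro card_mono) (auto simp: M_def)
    finally show ?case by simp
  qed
qed

text \<open>The factor \<open>1 / 2\<close> in the count costs \<open>1 / n\<close> in the exponent, which is lost in the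
  limit.\<close>

lemma F_lower_at_ge:
  assumes "subdifferential_0 (c_fun D S J) = {a..b}" and "a \<le> b"
    and "- a < \<alpha>" and "0 < \<beta>" and "\<beta> < - b"
  shows "ereal \<beta> * q_lower D S J \<le> F_lower_at D S J \<alpha>"
proof -
  have "ereal \<beta> * q_lower D S J = liminf (\<lambda>n. ereal \<beta> * ereal (zero n))"
    unfolding q_lower_def using assms by (intro Liminf_ereal_mult_left[symmetric]) auto
  also have "\<dots> = 0 + \<dots>" by simp
  also have "\<dots> = liminf (\<lambda>n. ereal (- (1 / real n)) + ereal \<beta> * ereal (zero n))"
  proof (rule ereal_liminf_lim_add[symmetric])
    have "(\<lambda>n. ereal (- (1 / real n))) \<longlonglongrightarrow> ereal (- 0)"
      by (intro tendsto_ereal tendsto_minus lim_1_over_n)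
    thus "(\<lambda>n. ereal (- (1 / real n))) \<longlonglongrightarrow> 0"
      by (simp add: zero_ereal_def)
  qed auto
  also have "\<dots> \<le> F_lower_at D S J \<alpha>"
    unfolding F_lower_at_def
  proof (rule Liminf_mono)
    show "\<forall>\<^sub>F n in sequentially. ereal (- (1 / real n)) + ereal \<beta> * ereal (zero n)
            \<le> ereal (log_plus (real (N_count D S J \<alpha> n)) / ln (2 ^ n))"
      using eventually_N_count_ge[OF assms] eventually_gt_at_top[of 0]
    proof eventually_elim
      case (elim n)
      let ?N = "real (N_count D S J \<alpha> n)"
      have "\<beta> * real n * zero n * ln 2 - ln 2 = ln (2 powr (\<beta> * real n * zero n) / 2)"
        by (simp add: ln_div ln_powr)
      also have "\<dots> \<le> ln ?N"
      proof -
        have "0 < 2 powr (\<beta> * real n * zero n) / 2" by simp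
        with elim show ?thesis by (intro ln_mono) auto
      qed
      also have "\<dots> \<le> log_plus ?N"
        by (simp add: log_plus_def)
      also have "\<beta> * real n * zero n * ln 2 - ln 2 = (\<beta> * zero n - 1 / real n) * (real n * ln 2)"
        using elim by (simp add: field_simps)
      finally have "(\<beta> * zero n - 1 / real n) * (real n * ln 2) \<le> log_plus ?N" .
      thus ?case
        using elim by (simp add: ln_realpow pos_le_divide_eq)
    qed
  qed
  finally show ?thesis .
qed

lemma slope_ratio_q_lower_le_F_lower:
  assumes "subdifferential_0 (c_fun D S J) = {a..b}" and "a \<le> b" and "b < 0"
  shows "ereal (b / a) * q_lower D S J \<le> F_lower D S J"
proof (rule tendsto_upperbound)
  (* the quotient \<beta> / \<alpha> for \<beta> = - b * (1 - \<epsilon>) and \<alpha> = - a * (1 + \<epsilon>); its limit b / a is positive,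
     so that multiplication by q_lower D S J is continuous there even at infinity *)
  let ?r = "\<lambda>\<epsilon>. (- b * (1 - \<epsilon>)) / (- a * (1 + \<epsilon>))"
  have "(?r \<longlongrightarrow> (- b * (1 - 0)) / (- a * (1 + 0))) (at_right 0)"
    using assms by (intro tendsto_intros) auto
  hence "((\<lambda>\<epsilon>. ereal (?r \<epsilon>)) \<longlongrightarrow> ereal (b / a)) (at_right 0)"
    by (intro tendsto_ereal) simp
  thus "((\<lambda>\<epsilon>. ereal (?r \<epsilon>) * q_lower D S J) \<longlongrightarrow> ereal (b / a) * q_lower D S J) (at_right 0)"
    using assms by (intro tendsto_mult_ereal tendsto_const) (auto simp: zero_ereal_def)
  have "\<forall>\<^sub>F \<epsilon> in at_right 0. \<epsilon> \<in> {0<..<1::real}"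
    by (intro eventually_at_right_real) simp
  thus "\<forall>\<^sub>F \<epsilon> in at_right 0. ereal (?r \<epsilon>) * q_lower D S J \<le> F_lower D S J"
  proof eventually_elim
    case (elim \<epsilon>)
    define \<alpha> \<beta> where "\<alpha> = - a * (1 + \<epsilon>)" and "\<beta> = - b * (1 - \<epsilon>)"
    have "0 < - a * \<epsilon>" "0 < - b * \<epsilon>"
      using assms elim by (auto simp: mult_less_0_iff)
    hence \<alpha>\<beta>: "- a < \<alpha>" "0 < \<beta>" "\<beta> < - b"
      using assms elim by (auto simp: \<alpha>_def \<beta>_def algebra_simps mult_less_0_iff)
    hence "\<alpha> > 0" using assms by linarith
    have "ereal (\<beta> / \<alpha>) * q_lower D S J = ereal \<beta> * q_lower D S J / ereal \<alpha>"
      using \<open>\<alpha> > 0\<close> by (simp add: divide_ereal_def divide_inverse mult_ac flip: times_ereal.simps)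
    also have "\<dots> \<le> F_lower_at D S J \<alpha> / ereal \<alpha>"
      using F_lower_at_ge[OF assms(1,2) \<alpha>\<beta>] \<open>\<alpha> > 0\<close> by (intro ereal_divide_right_mono) auto
    also have "\<dots> \<le> F_lower D S J"
      unfolding F_lower_def using \<open>\<alpha> > 0\<close> by (intro SUP_upper) auto
    finally show ?case by (simp add: \<alpha>_def \<beta>_def)
  qed
qed auto

end

section \<open>Dyadic partitions under the standing assumptions\<close>

text \<open>A member of \<open>D (Suc n)\<close> meets some member of \<open>D n\<close>, and hence one of the finitely many
  members of \<open>D (Suc n)\<close> into which the latter splits; by disjointness it coincides with it.\<close>

lemma finite_dyadic_partition:
  fixes Q0 :: "(real ^ 'd) set"
  assumes "dyadic_partitions Q0 D"
  shows "finite (D n)"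
proof (induction n)
  case 0
  show ?case using assms by (simp add: dyadic_partitions_def)
next
  case (Suc n)
  have part: "partition_on Q0 (D k)" for k
    using assms by (simp add: dyadic_partitions_def)
  have "\<forall>n. \<forall>Q\<in>D n. \<exists>C \<subseteq> D (Suc n). card C = 2 ^ CARD('d) \<and> disjoint C \<and> \<Union>C = Q"
    using assms unfolding dyadic_partitions_def by (elim conjE)
  then obtain C where C: "\<And>Q. Q \<in> D n \<Longrightarrow> C Q \<subseteq> D (Suc n) \<and> card (C Q) = 2 ^ CARD('d) \<and> \<Union>(C Q) = Q"
    by metis
  have "D (Suc n) \<subseteq> (\<Union>Q\<in>D n. C Q)"
  proof
    fix R assume R: "R \<in> D (Suc n)"
    then obtain x where "x \<in> R"
      using partition_onD3[OF part] by (metis ex_in_conv)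
    with R have "x \<in> Q0" using partition_onD1[OF part] by blast
    then obtain Q where Q: "Q \<in> D n" "x \<in> Q"
      using partition_onD1[OF part[of n]] by blast
    with C obtain R' where R': "R' \<in> C Q" "x \<in> R'" by blast
    hence "R' \<in> D (Suc n)" using C Q by blast
    hence "R' = R"
      using partition_onD2[OF part] R \<open>x \<in> R\<close> R' by (metis disjointD disjoint_iff)
    with R' Q show "R \<in> (\<Union>Q\<in>D n. C Q)" by blast
  qed
  moreover have "finite (C Q)" if "Q \<in> D n" for Q
    using C[OF that] by (intro card_ge_0_finite) simp
  ultimately show ?case
    using Suc by (meson finite_UN_I finite_subset)
qed

text \<open>Once some cell has a positive value, local non-vanishing passes positivity on to all later
  generations; uniform vanishing pushes the values below \<open>1\<close>.\<close>

lemma small_cells_if_standing_assumptions: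
  fixes Q0 :: "(real ^ 'd) set"
  assumes D: "dyadic_partitions Q0 D" and S: "S \<subseteq> (\<Union>n. D n)"
    and J: "standing_assumptions D S J"
  shows "small_cells D S J"
proof
  fix n show "finite (level D S n)"
    using finite_dyadic_partition[OF D] by (simp add: level_def)
next
  obtain Q where "Q \<in> S" "J Q > 0"
    using J unfolding standing_assumptions_def by (metis order_le_less)
  then obtain m where m: "Q \<in> level D S m" "J Q > 0"
    using S by (auto simp: level_def)
  have "\<exists>Q\<in>level D S n. J Q > 0" if "n \<ge> m" for n
    using that
  proof (induction n rule: dec_induct)
    case base
    show ?case using m by blast
  next
    case (step n)
    thus ?case using J unfolding standing_assumptions_def by blast
  qed
  thus "\<forall>\<^sub>F n in sequentially. \<exists>Q\<in>level D S n. J Q > 0"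
    by (auto simp: eventually_sequentially)
next
  have "(\<lambda>n. SUP Q \<in> (\<Union>k\<in>{n..}. level D S k). ereal (J Q)) \<longlonglongrightarrow> 0"
    using J unfolding standing_assumptions_def by blast
  hence "\<forall>\<^sub>F n in sequentially. (SUP Q \<in> (\<Union>k\<in>{n..}. level D S k). ereal (J Q)) < 1"
    by (rule order_tendstoD) simp
  thus "\<forall>\<^sub>F n in sequentially. \<forall>Q\<in>level D S n. J Q < 1"
  proof eventually_elim
    case (elim n)
    show ?case
    proof
      fix Q assume "Q \<in> level D S n"
      hence "ereal (J Q) \<le> (SUP Q \<in> (\<Union>k\<in>{n..}. level D S k). ereal (J Q))"
        by (intro SUP_upper) auto
      also note elim
      finally show "J Q < 1" by simp
    qed
  qed
qed

theorem proposition1p14: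
  fixes Q0 :: "(real ^ 'd) set"
    and D :: "nat \<Rightarrow> (real ^ 'd) set set"
    and S :: "(real ^ 'd) set set"
    and J :: "(real ^ 'd) set \<Rightarrow> real"
    and a b :: real
  assumes "dyadic_partitions Q0 D"
    and "S \<subseteq> (\<Union>n. D n)"
    and "standing_assumptions D S J"
    and "dim_infinity D S J > 0"
    and "a \<le> b" and "b < 0"
    and "subdifferential_0 (c_fun D S J) = {a..b}"
  shows "ereal (b / a) * q_lower D S J \<le> F_lower D S J \<and> F_lower D S J \<le> q_lower D S J"
proof -
  interpret small_cells D S J
    using assms(1-3) by (rule small_cells_if_standing_assumptions)
  show ?thesis
    using slope_ratio_q_lower_le_F_lower[OF assms(7,5,6)] F_lower_le_q_lower by blast
qed

end
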